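(* Let $A(x),B(x)\in\mathbb{Z}[x]$ be coprime monic polynomials, let $\Delta$ be their resultant, and let $G(n)=\gcd(A(n),B(n))$ for $n\in\mathbb{Z}$. Let $\ell\le\deg(A)+\deg(B)$ and let $n_1,\dots,n_\ell\in\mathbb{Z}$ and integers $q_1,\dots,q_\ell$ be such that $q_i$ divides $G(n_i)$ for $i=1,\dots,\ell$. Then $q_1q_2\cdots q_\ell$ divides $\Delta\times\prod_{1\le i<j\le\ell}(n_j-n_i)$. In particular, if $p$ is a prime, $p^{\omega_1}$ divides $G(n_1)$ and $p^{\omega_2}$ divides $G(n_2)$, then $\nu_p(n_2-n_1)\ge\omega_1+\omega_2-\nu_p(\Delta)$.
   Context: For monic $A(x)=x^d+\cdots+a_0$ and $B(x)=x^e+\cdots+b_0$, the resultant $\Delta$ is the determinant of the $(d+e)\times(d+e)$ Sylvester matrix, whose first $e$ columns contain the coefficients of $A$ (from leading to constant) shifted down by one row in each successive column, and whose last $d$ columns contain the coefficients of $B$ shifted down by one row in each successive column. $\nu_p$ denotes the $p$-adic valuation, with $\nu_p(0)=+\infty$. *)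

theory Defs
  imports
    "Subresultants.Resultant_Prelim"
    "HOL-Computational_Algebra.Computational_Algebra"
    "HOL-Library.Extended_Real"
begin

text \<open>
  The library matrix \<open>sylvester_mat A B\<close> carries the shifted coefficient lists of \<open>A\<close> and \<open>B\<close> in its
  rows; the convention used here puts them in the columns. The determinant is the same.
\<close>

lemma resultant_eq_det_columns:
  fixes A B :: "'a :: comm_ring_1 poly"
  shows "resultant A B = det (transpose_mat (sylvester_mat A B))"
  by (simp add: resultant_def det_transpose[OF sylvester_carrier_mat])

text \<open>
  The valuation takes values in the extended reals so that \<open>\<nu>\<^sub>p(0) = \<infinity>\<close> and differences
  of valuations may be negative (\<open>multiplicity p 0\<close> is \<open>0\<close> in the library).
\<close>

definition padic_val :: "int \<Rightarrow> int \<Rightarrow> ereal" where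
  "padic_val p n = (if n = 0 then \<infinity> else ereal (real (multiplicity p n)))"

end

theory Submission
  imports Defs
begin

text \<open>
  Read the rows of the Sylvester matrix as polynomials \<open>x\<^sup>k A\<close> and \<open>x\<^sup>k B\<close>, and multiply it by the
  matrix whose first \<open>l\<close> columns are the power vectors of \<open>n\<^sub>1, \<dots>, n\<^sub>l\<close> and whose remaining columns are
  unit vectors. The determinant of the second factor is the Vandermonde determinant of the \<open>n\<^sub>i\<close>, and
  the \<open>i\<close>-th column of the product consists of values \<open>n\<^sub>i\<^sup>k A(n\<^sub>i)\<close> and \<open>n\<^sub>i\<^sup>k B(n\<^sub>i)\<close>, all divisible
  by \<open>q\<^sub>i\<close>.
\<close>

text \<open>Padding with zero coefficients to a common length \<open>n\<close> lets one matrix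
  product evaluate all polynomials of degree below \<open>n\<close>.\<close>

lemma poly_eq_sum_coeff:
  fixes p :: "'a :: comm_semiring_1 poly"
  assumes "degree p < n"
  shows "poly p x = (\<Sum>k<n. coeff p k * x ^ k)"
proof -
  have "poly p x = (\<Sum>k\<le>degree p. coeff p k * x ^ k)"
    by (rule poly_altdef)
  also have "\<dots> = (\<Sum>k<n. coeff p k * x ^ k)"
    by (rule sum.mono_neutral_left) (use assms in \<open>auto simp: coeff_eq_0\<close>)
  finally show ?thesis .
qed

text \<open>The nodes index the columns, so that a matrix of coefficient rows multiplied from the
  left evaluates its row polynomials at the nodes.\<close>

definition vandermonde_mat :: "nat \<Rightarrow> (nat \<Rightarrow> 'a :: comm_ring_1) \<Rightarrow> 'a mat" where
  "vandermonde_mat l x = mat l l (\<lambda>(i, j). x j ^ i)"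

definition newton_poly :: "(nat \<Rightarrow> 'a :: idom) \<Rightarrow> nat \<Rightarrow> 'a poly" where
  "newton_poly x i = (\<Prod>k<i. [:- x k, 1:])"

lemma degree_newton_poly [simp]: "degree (newton_poly x i) = i"
  unfolding newton_poly_def by (subst degree_prod_eq_sum_degree) auto

lemma coeff_newton_poly_self [simp]: "coeff (newton_poly x i) i = 1"
proof -
  have "lead_coeff (newton_poly x i) = 1"
    unfolding newton_poly_def by (subst lead_coeff_prod) simp
  then show ?thesis by simp
qed

lemma poly_newton_poly: "poly (newton_poly x i) y = (\<Prod>k<i. y - x k)"
  by (simp add: newton_poly_def poly_prod)

text \<open>
  The unitriangular coefficient matrix of the Newton polynomials makes the Vandermonde matrix
  triangular, because the \<open>i\<close>-th Newton polynomial vanishes at the first \<open>i\<close> nodes.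
\<close>

lemma det_vandermonde_mat:
  fixes x :: "nat \<Rightarrow> 'a :: idom"
  shows "det (vandermonde_mat l x) = (\<Prod>j<l. \<Prod>i<j. x j - x i)"
proof -
  define T where "T = mat l l (\<lambda>(i, k). coeff (newton_poly x i) k)"
  define U where "U = mat l l (\<lambda>(i, j). \<Prod>k<i. x j - x k)"
  have T: "T \<in> carrier_mat l l" and U: "U \<in> carrier_mat l l"
    and V: "vandermonde_mat l x \<in> carrier_mat l l"
    by (auto simp: T_def U_def vandermonde_mat_def)
  have "T * vandermonde_mat l x = U"
  proof (rule eq_matI)
    fix i j assume "i < dim_row U" "j < dim_col U"
    then have ij: "i < l" "j < l" by (auto simp: U_def)
    then have "(T * vandermonde_mat l x) $$ (i, j) = (\<Sum>k<l. coeff (newton_poly x i) k * x j ^ k)"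
      by (simp add: T_def vandermonde_mat_def scalar_prod_def atLeast0LessThan)
    also have "\<dots> = poly (newton_poly x i) (x j)"
      using ij by (simp add: poly_eq_sum_coeff[of _ l])
    finally show "(T * vandermonde_mat l x) $$ (i, j) = U $$ (i, j)"
      using ij by (simp add: U_def poly_newton_poly)
  qed (auto simp: T_def U_def vandermonde_mat_def)
  then have "det U = det T * det (vandermonde_mat l x)"
    using det_mult[OF T V] by simp
  moreover have "det T = 1"
  proof -
    have "det T = prod_list (diag_mat T)"
      by (rule det_lower_triangular[OF _ T]) (simp add: T_def coeff_eq_0)
    then show ?thesis by (simp add: prod_list_diag_prod T_def)
  qed
  moreover have "det U = (\<Prod>j<l. \<Prod>i<j. x j - x i)"
  proof -
    have "upper_triangular U"
      by (rule upper_triangularI) (auto simp: U_def)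
    then have "det U = prod_list (diag_mat U)"
      by (rule det_upper_triangular[OF _ U])
    then show ?thesis by (simp add: prod_list_diag_prod U_def atLeast0LessThan)
  qed
  ultimately show ?thesis by simp
qed

text \<open>Each term of the Leibniz expansion takes exactly one entry from every column, so it
  collects every factor \<open>r j\<close> once.\<close>

lemma prod_dvd_det:
  fixes M :: "'a :: comm_ring_1 mat"
  assumes M: "M \<in> carrier_mat m m"
    and dvd: "\<And>i j. i < m \<Longrightarrow> j < m \<Longrightarrow> r j dvd M $$ (i, j)"
  shows "(\<Prod>j<m. r j) dvd det M"
  unfolding det_def'[OF M]
proof (rule dvd_sum)
  fix p assume "p \<in> {p. p permutes {0..<m}}"
  then have p: "p permutes {0..<m}" by simp
  have "(\<Prod>j<m. r j) = (\<Prod>i = 0..<m. r (p i))"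
    using prod.permute[OF p, of r] by (simp add: atLeast0LessThan o_def)
  also have "\<dots> dvd (\<Prod>i = 0..<m. M $$ (i, p i))"
    using permutes_in_image[OF p] by (intro prod_dvd_prod dvd) auto
  finally show "(\<Prod>j<m. r j) dvd signof p * (\<Prod>i = 0..<m. M $$ (i, p i))"
    by (rule dvd_mult)
qed

text \<open>Sylvester rows list coefficients from the highest power down. With m =
  \<open>degree A + degree B\<close>, column \<open>j\<close> therefore belongs to the power m - 1 -
  \<open>j\<close>, and the multipliers of \<open>A\<close> and \<open>B\<close> descend to
  1.\<close>

definition sylvester_row_poly :: "'a :: comm_ring_1 poly \<Rightarrow> 'a poly \<Rightarrow> nat \<Rightarrow> 'a poly" where
  "sylvester_row_poly A B i =
     (if i < degree B then monom 1 (degree B - 1 - i) * A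
      else monom 1 (degree A + degree B - 1 - i) * B)"

lemma sylvester_mat_index_row_poly:
  assumes "i < degree A + degree B" "j < degree A + degree B"
  shows "sylvester_mat A B $$ (i, j) =
    coeff (sylvester_row_poly A B i) (degree A + degree B - 1 - j)"
  using assms
  by (auto simp: sylvester_index_mat sylvester_row_poly_def coeff_monom_mult coeff_eq_0
      intro!: arg_cong[of _ _ "coeff A"] arg_cong[of _ _ "coeff B"])

text \<open>This bound ensures that the entries of a row contain all coefficients of its polynomial,
  so that a row times a power vector is a full evaluation.\<close>

lemma degree_sylvester_row_poly_less:
  assumes "i < degree A + degree B"
  shows "degree (sylvester_row_poly A B i) < degree A + degree B"
proof (cases "i < degree B")
  case True
  have "degree (monom 1 (degree B - 1 - i) * A) \<le> (degree B - 1 - i) + degree A"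
    by (rule order_trans[OF degree_mult_le]) (simp add: degree_monom_le)
  then show ?thesis using True by (simp add: sylvester_row_poly_def)
next
  case False
  have "degree (monom 1 (degree A + degree B - 1 - i) * B)
      \<le> (degree A + degree B - 1 - i) + degree B"
    by (rule order_trans[OF degree_mult_le]) (simp add: degree_monom_le)
  then show ?thesis using False assms by (simp add: sylvester_row_poly_def)
qed

lemma dvd_poly_sylvester_row_poly:
  assumes "q dvd poly A x" "q dvd poly B x"
  shows "q dvd poly (sylvester_row_poly A B i) x"
  using assms by (simp add: sylvester_row_poly_def poly_monom)

lemma prod_dvd_resultant_mult_vandermonde:
  fixes A B :: "'a :: idom poly"
  assumes l: "l \<le> degree A + degree B"
    and q: "\<And>j. j < l \<Longrightarrow> q j dvd poly A (x j)" "\<And>j. j < l \<Longrightarrow> q j dvd poly B (x j)"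
  shows "(\<Prod>j<l. q j) dvd resultant A B * (\<Prod>j<l. \<Prod>i<j. x j - x i)"
proof -
  define m where "m = degree A + degree B"
  define P where "P = sylvester_row_poly A B"
  define K where "K = mat m m (\<lambda>(i, j). coeff (P i) j)"
  \<comment> \<open>\<open>R\<close> reverses the columns, turning the ascending powers in
    \<open>K\<close> into the descending ones of the Sylvester matrix.\<close>
  define R where "R = mat m m (\<lambda>(i, j). if i = m - 1 - j then 1 else 0 :: 'a)"
  \<comment> \<open>The lower left block continues the power vectors to height \<open>m\<close>, and
    the identity block completes the matrix to a square one. The zero block then reduces the
    determinant to that of the Vandermonde block.\<close>
  define W where "W = four_block_mat (vandermonde_mat l x) (0\<^sub>m l (m - l))
    (mat (m - l) l (\<lambda>(i, j). x j ^ (i + l))) (1\<^sub>m (m - l))"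
  have lm: "l \<le> m" using l by (simp add: m_def)
  have K: "K \<in> carrier_mat m m" and R: "R \<in> carrier_mat m m"
    by (auto simp: K_def R_def)
  have W: "W \<in> carrier_mat m m"
    using lm by (auto simp: W_def vandermonde_mat_def)
  have "sylvester_mat A B = K * R"
  proof (rule eq_matI)
    fix i j assume "i < dim_row (K * R)" "j < dim_col (K * R)"
    then have ij: "i < m" "j < m" by (auto simp: K_def R_def)
    then have "(K * R) $$ (i, j) = (\<Sum>k<m. coeff (P i) k * (if k = m - 1 - j then 1 else 0))"
      by (simp add: K_def R_def scalar_prod_def atLeast0LessThan)
    also have "\<dots> = (\<Sum>k<m. if k = m - 1 - j then coeff (P i) k else 0)"
      by (rule sum.cong) auto
    also have "\<dots> = coeff (P i) (m - 1 - j)"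
      using ij by (subst sum.delta) auto
    finally show "sylvester_mat A B $$ (i, j) = (K * R) $$ (i, j)"
      using ij by (simp add: sylvester_mat_index_row_poly m_def P_def)
  qed (auto simp: K_def R_def m_def)
  then have res: "resultant A B = det K * det R"
    by (simp add: resultant_def det_mult[OF K R])
  have detW: "det W = (\<Prod>j<l. \<Prod>i<j. x j - x i)"
    unfolding W_def
    by (subst det_four_block_mat_upper_right_zero)
      (auto simp: vandermonde_mat_def[of l x] det_vandermonde_mat[unfolded vandermonde_mat_def])
  have W_index: "W $$ (k, j) = x j ^ k" if "k < m" "j < l" for k j
    using that lm by (auto simp: W_def vandermonde_mat_def)
  \<comment> \<open>The columns that complete \<open>W\<close> receive the trivial divisor
    1.\<close>
  have "(\<Prod>j<l. q j) = (\<Prod>j<m. if j < l then q j else 1)"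
    using lm by (intro prod.mono_neutral_cong_left) auto
  also have "\<dots> dvd det (K * W)"
  proof (rule prod_dvd_det)
    fix i j assume ij: "i < m" "j < m"
    show "(if j < l then q j else 1) dvd (K * W) $$ (i, j)"
    proof (cases "j < l")
      case True
      have "(K * W) $$ (i, j) = (\<Sum>k<m. coeff (P i) k * W $$ (k, j))"
        using ij W by (simp add: K_def scalar_prod_def atLeast0LessThan)
      also have "\<dots> = (\<Sum>k<m. coeff (P i) k * x j ^ k)"
        using True by (simp add: W_index)
      also have "\<dots> = poly (P i) (x j)"
        using degree_sylvester_row_poly_less[of i A B] ij
        by (simp add: poly_eq_sum_coeff[of _ m] P_def m_def)
      finally show ?thesis
        using True q by (simp add: P_def dvd_poly_sylvester_row_poly)
    qed simp
  qed (use K W in auto)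
  \<comment> \<open>By \<open>res\<close>, \<open>det K\<close> divides the resultant, whatever the
    sign \<open>det R\<close> is.\<close>
  also have "det (K * W) dvd resultant A B * det W"
    by (simp add: det_mult[OF K W] res)
  finally show ?thesis by (simp add: detW)
qed

text \<open>Shifting both indices down by one and grouping the pairs by the larger index links the
  1-based product of the theorem to the 0-based Vandermonde product.\<close>

lemma prod_pairs_eq_nested_prod:
  fixes f :: "nat \<Rightarrow> nat \<Rightarrow> 'a :: comm_monoid_mult"
  shows "(\<Prod>(i, j)\<in>{(i, j). 1 \<le> i \<and> i < j \<and> j \<le> l}. f i j) = (\<Prod>j<l. \<Prod>i<j. f (Suc i) (Suc j))"
proof -
  have "(\<Prod>j<l. \<Prod>i<j. f (Suc i) (Suc j)) = (\<Prod>(j, i)\<in>(SIGMA j:{..<l}. {..<j}). f (Suc i) (Suc j))"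
    by (rule prod.Sigma) auto
  also have "\<dots> = (\<Prod>(i, j)\<in>{(i, j). 1 \<le> i \<and> i < j \<and> j \<le> l}. f i j)"
    by (rule prod.reindex_bij_witness[where i = "\<lambda>(i, j). (j - 1, i - 1)"
          and j = "\<lambda>(j, i). (Suc i, Suc j)"]) auto
  finally show ?thesis ..
qed

lemma prod_dvd_resultant_mult_differences:
  fixes A B :: "int poly"
  assumes l: "l \<le> degree A + degree B"
    and q: "\<And>i. i \<in> {1..l} \<Longrightarrow> q i dvd gcd (poly A (n i)) (poly B (n i))"
  shows "(\<Prod>i\<in>{1..l}. q i) dvd
    resultant A B * (\<Prod>(i, j)\<in>{(i, j). 1 \<le> i \<and> i < j \<and> j \<le> l}. n j - n i)"
proof -
  have "(\<Prod>i\<in>{1..l}. q i) = (\<Prod>j<l. q (Suc j))"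
    by (rule prod.reindex_bij_witness[where i = Suc and j = "\<lambda>i. i - 1"]) auto
  also have "\<dots> dvd resultant A B * (\<Prod>j<l. \<Prod>i<j. n (Suc j) - n (Suc i))"
    using q by (intro prod_dvd_resultant_mult_vandermonde l) auto
  finally show ?thesis
    by (subst prod_pairs_eq_nested_prod)
qed

text \<open>With degree sum at least 2 this is the case of two nodes. Smaller degree sums fall
  outside the general bound and are treated directly.\<close>

lemma mult_dvd_resultant_mult_diff:
  fixes A B :: "int poly"
  assumes monic: "lead_coeff A = 1" "lead_coeff B = 1"
    and a: "a dvd gcd (poly A x) (poly B x)" and b: "b dvd gcd (poly A y) (poly B y)"
  shows "a * b dvd resultant A B * (y - x)"
proof (cases "degree A + degree B \<ge> 2")
  case True
  define q where "q j = (if j = 0 then a else b)" for j :: nat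
  define n where "n j = (if j = 0 then x else y)" for j :: nat
  have "(\<Prod>j<2. q j) dvd resultant A B * (\<Prod>j<2. \<Prod>i<j. n j - n i)"
    using a b by (intro prod_dvd_resultant_mult_vandermonde True) (auto simp: q_def n_def)
  then show ?thesis by (simp add: numeral_2_eq_2 q_def n_def)
next
  case False
  then have "degree A = 0 \<or> degree B = 0" by linarith
  \<comment> \<open>A constant monic polynomial is 1, which makes both gcds equal to 1.\<close>
  then have "A = 1 \<or> B = 1" using monic by (auto elim!: degree_eq_zeroE)
  then have "is_unit a" "is_unit b" using a b by auto
  then show ?thesis by (meson dvd_trans is_unit_mult_iff one_dvd)
qed

lemma padic_val_diff_ge:
  fixes p c d :: int
  assumes p: "prime p" and dvd: "p ^ v dvd c * d"
  shows "padic_val p d \<ge> ereal (real v) - padic_val p c"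
proof (cases "c = 0 \<or> d = 0")
  case True
  \<comment> \<open>For \<open>d = 0\<close> the left side is \<infinity>; for \<open>c = 0\<close>
    the right side is -\<infinity>.\<close>
  then show ?thesis by (auto simp: padic_val_def)
next
  case False
  then have "v \<le> multiplicity p (c * d)"
    using p dvd by (intro multiplicity_geI) auto
  also have "\<dots> = multiplicity p c + multiplicity p d"
    using p False by (intro prime_elem_multiplicity_mult_distrib) auto
  finally show ?thesis using False by (simp add: padic_val_def)
qed

theorem theorem7:
  fixes A B :: "int poly"
  assumes "lead_coeff A = 1" and "lead_coeff B = 1" and "coprime A B"
  shows "(\<forall>(l::nat) (n::nat \<Rightarrow> int) (q::nat \<Rightarrow> int).
            l \<le> degree A + degree B \<longrightarrow>
            (\<forall>i\<in>{1..l}. q i dvd gcd (poly A (n i)) (poly B (n i))) \<longrightarrow>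
            (\<Prod>i\<in>{1..l}. q i) dvd
              resultant A B * (\<Prod>(i, j)\<in>{(i, j). 1 \<le> i \<and> i < j \<and> j \<le> l}. n j - n i))
       \<and> (\<forall>(p::int) (\<omega>\<^sub>1::nat) (\<omega>\<^sub>2::nat) (n\<^sub>1::int) (n\<^sub>2::int).
            prime p \<longrightarrow>
            p ^ \<omega>\<^sub>1 dvd gcd (poly A n\<^sub>1) (poly B n\<^sub>1) \<longrightarrow>
            p ^ \<omega>\<^sub>2 dvd gcd (poly A n\<^sub>2) (poly B n\<^sub>2) \<longrightarrow>
            padic_val p (n\<^sub>2 - n\<^sub>1) \<ge>
              ereal (real \<omega>\<^sub>1) + ereal (real \<omega>\<^sub>2) - padic_val p (resultant A B))"
proof (intro conjI allI impI, goal_cases)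
  case (1 l n q)
  then show ?case by (intro prod_dvd_resultant_mult_differences) auto
next
  case (2 p \<omega>\<^sub>1 \<omega>\<^sub>2 n\<^sub>1 n\<^sub>2)
  have "p ^ (\<omega>\<^sub>1 + \<omega>\<^sub>2) dvd resultant A B * (n\<^sub>2 - n\<^sub>1)"
    using mult_dvd_resultant_mult_diff[OF assms(1,2) 2(2,3)] by (simp add: power_add)
  from padic_val_diff_ge[OF 2(1) this] show ?case by simp
qed

end
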